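(* Let $i\geq 3$ and $j\geq 2i+1$ be integers, and let $(G,\mathbf{c})$ be a weighted pair (with $G$ a simple graph) such that $G$ is $\mathbf{c}$-critical. Then $\rho(G,\mathbf{c})\leq i-j-1$.
   Context: Let $G$ be a simple graph. A 2-fold cover of $G$ is a pair $\mathcal{H}=(L,H)$ where $H$ is a graph and $L:V(G)\to 2^{V(H)}$ is such that: the sets $L(u)$ partition $V(H)$; $|L(u)|=2$ and $H[L(u)]$ is complete for every $u$; edges of $H$ between $L(u)$ and $L(v)$, $u\ne v$, exist only if $uv\in E(G)$; and for each edge $uv\in E(G)$ the edges of $H$ between $L(u)$ and $L(v)$ form a matching. Write $L(u)=\{p(u),r(u)\}$ (poor and rich vertex). An $\mathcal{H}$-map is a function $\phi:V(G)\to V(H)$ with $\phi(v)\in L(v)$; $H_\phi$ is the subgraph of $H$ induced by $\phi(V(G))$. A capacity function is a map $\mathbf{c}:V(G)\to\{-1,0,\dots,i\}\times\{-1,0,\dots,j\}$, written $\mathbf{c}(u)=(\mathbf{c}_1(u),\mathbf{c}_2(u))$; $(G,\mathbf{c})$ is called a weighted pair. A $(\mathbf{c},\mathcal{H})$-coloring of $G$ is an $\mathcal{H}$-map $\phi$ such that for each $u\in V(G)$: if $\phi(u)=p(u)$ then its degree in $H_\phi$ is at most $\mathbf{c}_1(u)$, and if $\phi(u)=r(u)$ then its degree in $H_\phi$ is at most $\mathbf{c}_2(u)$ (so a vertex of capacity $-1$ can never be chosen). $G$ is $\mathbf{c}$-colorable if it has a $(\mathbf{c},\mathcal{H})$-coloring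 for every 2-fold cover $\mathcal{H}$, and $\mathbf{c}$-critical if it is not $\mathbf{c}$-colorable but every proper subgraph of $G$ (with $\mathbf{c}$ restricted) is. The potential of a vertex is $\rho_{\mathbf{c}}(u)=i-j+1+\mathbf{c}_1(u)+\mathbf{c}_2(u)$; for $S\subseteq V(G)$, $\rho_{G,\mathbf{c}}(S)=\sum_{u\in S}\rho_{\mathbf{c}}(u)-(i+1)|E(G[S])|$; and $\rho(G,\mathbf{c})=\min_{S\subseteq V(G)}\rho_{G,\mathbf{c}}(S)$. *)

theory Defs
  imports Main "HOL-Library.Disjoint_Sets"
begin

section \<open>Finite simple graphs\<close>

record 'a ugraph =
  verts :: "'a set"
  edges :: "'a set set"

definition simple_graph :: "'a ugraph \<Rightarrow> bool" where
  "simple_graph G \<longleftrightarrow> finite (verts G) \<and> (\<forall>e \<in> edges G. e \<subseteq> verts G \<and> card e = 2)"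

definition subgraph :: "'a ugraph \<Rightarrow> 'a ugraph \<Rightarrow> bool" where
  "subgraph G' G \<longleftrightarrow> simple_graph G' \<and> verts G' \<subseteq> verts G \<and> edges G' \<subseteq> edges G"

definition induced :: "'a ugraph \<Rightarrow> 'a set \<Rightarrow> 'a ugraph" where
  "induced G S = \<lparr>verts = verts G \<inter> S, edges = {e \<in> edges G. e \<subseteq> S}\<rparr>"

definition degree :: "'a ugraph \<Rightarrow> 'a \<Rightarrow> nat" where
  "degree G x = card {e \<in> edges G. x \<in> e}"

definition complete_graph :: "'a ugraph \<Rightarrow> bool" where
  "complete_graph G \<longleftrightarrow> (\<forall>x \<in> verts G. \<forall>y \<in> verts G. x \<noteq> y \<longrightarrow> {x, y} \<in> edges G)"

definition edges_between :: "'a ugraph \<Rightarrow> 'a set \<Rightarrow> 'a set \<Rightarrow> 'a set set" where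
  "edges_between G A B = {e \<in> edges G. \<exists>x \<in> A. \<exists>y \<in> B. e = {x, y}}"


section \<open>2-fold covers\<close>

text \<open>A matching is a set of pairwise disjoint edges, expressed by \<^const>\<open>disjoint\<close>;
  it need not be perfect.\<close>

definition two_fold_cover :: "'a ugraph \<Rightarrow> ('a \<Rightarrow> 'h set) \<Rightarrow> 'h ugraph \<Rightarrow> bool" where
  "two_fold_cover G L H \<longleftrightarrow>
     simple_graph H \<and>
     disjoint_family_on L (verts G) \<and> (\<Union>u \<in> verts G. L u) = verts H \<and>
     (\<forall>u \<in> verts G. card (L u) = 2 \<and> complete_graph (induced H (L u))) \<and>
     (\<forall>u \<in> verts G. \<forall>v \<in> verts G. u \<noteq> v \<longrightarrow>
        edges_between H (L u) (L v) \<noteq> {} \<longrightarrow> {u, v} \<in> edges G) \<and>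
     (\<forall>u \<in> verts G. \<forall>v \<in> verts G. {u, v} \<in> edges G \<longrightarrow>
        disjoint (edges_between H (L u) (L v)))"

text \<open>The naming of the poor vertex \<open>p u\<close> and the rich vertex \<open>r u\<close> of each \<open>L u\<close>.\<close>

definition poor_rich :: "'a ugraph \<Rightarrow> ('a \<Rightarrow> 'h set) \<Rightarrow> ('a \<Rightarrow> 'h) \<Rightarrow> ('a \<Rightarrow> 'h) \<Rightarrow> bool" where
  "poor_rich G L p r \<longleftrightarrow> (\<forall>u \<in> verts G. L u = {p u, r u})"

definition cover_map :: "'a ugraph \<Rightarrow> ('a \<Rightarrow> 'h set) \<Rightarrow> ('a \<Rightarrow> 'h) \<Rightarrow> bool" where
  "cover_map G L \<phi> \<longleftrightarrow> (\<forall>v \<in> verts G. \<phi> v \<in> L v)"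


section \<open>Weighted pairs and defective colorings\<close>

type_synonym 'a capacity = "'a \<Rightarrow> int \<times> int"

text \<open>Only the values of a capacity function on the vertices of the graph matter, so
  restricting it to a subgraph needs no separate operation.\<close>

definition weighted_pair :: "int \<Rightarrow> int \<Rightarrow> 'a ugraph \<Rightarrow> 'a capacity \<Rightarrow> bool" where
  "weighted_pair i j G c \<longleftrightarrow>
     simple_graph G \<and> (\<forall>u \<in> verts G. c u \<in> {-1..i} \<times> {-1..j})"

definition cover_coloring ::
  "'a ugraph \<Rightarrow> 'a capacity \<Rightarrow> ('a \<Rightarrow> 'h set) \<Rightarrow> 'h ugraph \<Rightarrow> ('a \<Rightarrow> 'h) \<Rightarrow> ('a \<Rightarrow> 'h) \<Rightarrow>
   ('a \<Rightarrow> 'h) \<Rightarrow> bool" where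
  "cover_coloring G c L H p r \<phi> \<longleftrightarrow>
     cover_map G L \<phi> \<and>
     (\<forall>u \<in> verts G.
        (\<phi> u = p u \<longrightarrow> int (degree (induced H (\<phi> ` verts G)) (\<phi> u)) \<le> fst (c u)) \<and>
        (\<phi> u = r u \<longrightarrow> int (degree (induced H (\<phi> ` verts G)) (\<phi> u)) \<le> snd (c u)))"

text \<open>A definition cannot quantify over the vertex type of the cover graph. As the cover graph
  has two vertices for each vertex of \<open>G\<close>, the type \<^typ>\<open>'a \<times> bool\<close> is large enough to
  hold an isomorphic copy of every cover; \<open>colorable_any_cover\<close> below shows that covers over
  arbitrary types are indeed accounted for.\<close>

definition colorable :: "'a ugraph \<Rightarrow> 'a capacity \<Rightarrow> bool" where
  "colorable G c \<longleftrightarrow>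
     (\<forall>(L :: 'a \<Rightarrow> ('a \<times> bool) set) H p r.
        two_fold_cover G L H \<and> poor_rich G L p r \<longrightarrow> (\<exists>\<phi>. cover_coloring G c L H p r \<phi>))"

definition critical :: "'a ugraph \<Rightarrow> 'a capacity \<Rightarrow> bool" where
  "critical G c \<longleftrightarrow>
     \<not> colorable G c \<and> (\<forall>G'. subgraph G' G \<and> G' \<noteq> G \<longrightarrow> colorable G' c)"


section \<open>Potential\<close>

definition vertex_potential :: "int \<Rightarrow> int \<Rightarrow> 'a capacity \<Rightarrow> 'a \<Rightarrow> int" where
  "vertex_potential i j c u = i - j + 1 + fst (c u) + snd (c u)"

definition set_potential :: "int \<Rightarrow> int \<Rightarrow> 'a ugraph \<Rightarrow> 'a capacity \<Rightarrow> 'a set \<Rightarrow> int" where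
  "set_potential i j G c S =
     (\<Sum>u \<in> S. vertex_potential i j c u) - (i + 1) * int (card (edges (induced G S)))"

definition potential :: "int \<Rightarrow> int \<Rightarrow> 'a ugraph \<Rightarrow> 'a capacity \<Rightarrow> int" where
  "potential i j G c = Min (set_potential i j G c ` Pow (verts G))"


section \<open>Independence of the vertex type of the cover\<close>

lemma colorable_any_cover:
  fixes G :: "'a ugraph" and L :: "'a \<Rightarrow> 'h set" and H :: "'h ugraph"
  assumes col: "colorable G c" and sg: "simple_graph G"
    and cov: "two_fold_cover G L H" and pr: "poor_rich G L p r"
  shows "\<exists>\<phi>. cover_coloring G c L H p r \<phi>"
proof -
  let ?V = "verts G"
  define g where "g = (\<lambda>(u, b). if b then p u else r u)"
  define L' where "L' = (\<lambda>u::'a. {u} \<times> (UNIV :: bool set))"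
  define H' where
    "H' = \<lparr>verts = ?V \<times> (UNIV :: bool set), edges = {e. e \<subseteq> ?V \<times> UNIV \<and> g ` e \<in> edges H}\<rparr>"
  define p' where "p' = (\<lambda>u::'a. (u, True))"
  define r' where "r' = (\<lambda>u::'a. (u, False))"
  have Lpr: "L u = {p u, r u}" if "u \<in> ?V" for u
    using pr that by (auto simp: poor_rich_def)
  have simpH: "simple_graph H" and disj: "disjoint_family_on L ?V"
    and un: "(\<Union>u \<in> ?V. L u) = verts H"
    using cov by (auto simp: two_fold_cover_def)
  have c2: "card (L u) = 2" and cmpl: "complete_graph (induced H (L u))" if "u \<in> ?V" for u
    using cov that by (auto simp: two_fold_cover_def)
  have ne: "p u \<noteq> r u" if "u \<in> ?V" for u
    using c2[OF that] Lpr[OF that] by auto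
  have gL: "g x \<in> L (fst x)" if "x \<in> ?V \<times> UNIV" for x
    using that Lpr by (auto simp: g_def)
  have inj: "inj_on g (?V \<times> UNIV)"
  proof (rule inj_onI)
    fix x y assume x: "x \<in> ?V \<times> UNIV" and y: "y \<in> ?V \<times> UNIV" and eq: "g x = g y"
    have "fst x = fst y"
    proof (rule ccontr)
      assume "fst x \<noteq> fst y"
      then have "L (fst x) \<inter> L (fst y) = {}"
        using disj x y unfolding disjoint_family_on_def mem_Times_iff by blast
      then show False using gL[OF x] gL[OF y] eq by auto
    qed
    then show "x = y" using eq x ne ne[symmetric] by (cases x; cases y) (auto simp: g_def split: if_splits)
  qed
  have L'V: "L' u \<subseteq> ?V \<times> UNIV" if "u \<in> ?V" for u using that by (auto simp: L'_def)
  have gL': "g ` L' u = L u" if "u \<in> ?V" for u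
    using Lpr[OF that] by (force simp: L'_def g_def UNIV_bool)
  have inj_img: "inj_on (image g) (Pow (?V \<times> UNIV))"
    using inj by (simp add: inj_on_image_Pow)
  have betw: "g ` e \<in> edges_between H (L u) (L v)" "e \<subseteq> ?V \<times> UNIV"
    if "e \<in> edges_between H' (L' u) (L' v)" "u \<in> ?V" "v \<in> ?V" for e u v
  proof -
    from that(1) obtain x y where xy: "x \<in> L' u" "y \<in> L' v" "e = {x, y}" "e \<in> edges H'"
      by (auto simp: edges_between_def)
    have "g x \<in> L u" "g y \<in> L v" using gL' that(2,3) xy(1,2) by blast+
    then show "g ` e \<in> edges_between H (L u) (L v)"
      using xy(3,4) by (auto simp: edges_between_def H'_def)
    show "e \<subseteq> ?V \<times> UNIV" using xy(4) by (auto simp: H'_def)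
  qed
  have cov': "two_fold_cover G L' H'"
    unfolding two_fold_cover_def
  proof (intro conjI ballI impI)
    show "simple_graph H'"
      unfolding simple_graph_def
    proof (intro conjI ballI)
      show "finite (verts H')" using sg by (simp add: H'_def simple_graph_def)
      fix e assume e: "e \<in> edges H'"
      then show "e \<subseteq> verts H'" by (simp add: H'_def)
      have "card (g ` e) = 2" using e simpH by (simp add: H'_def simple_graph_def)
      moreover have "inj_on g e" using e inj inj_on_subset by (fastforce simp: H'_def)
      ultimately show "card e = 2" by (simp add: card_image)
    qed
    show "disjoint_family_on L' ?V" by (auto simp: disjoint_family_on_def L'_def)
    show "(\<Union>u \<in> ?V. L' u) = verts H'" by (auto simp: H'_def L'_def)
  next
    fix u assume u: "u \<in> ?V"
    show "card (L' u) = 2" by (simp add: L'_def)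
    have "p u \<in> verts H" "r u \<in> verts H" using Lpr[OF u] un u by blast+
    then have "{p u, r u} \<in> edges H"
      using cmpl[OF u] ne[OF u] Lpr[OF u]
      by (auto simp: complete_graph_def induced_def)
    then show "complete_graph (induced H' (L' u))"
      using u by (auto simp: complete_graph_def induced_def H'_def L'_def g_def insert_commute split: if_splits)
  next
    fix u v assume uv: "u \<in> ?V" "v \<in> ?V" "u \<noteq> v" "edges_between H' (L' u) (L' v) \<noteq> {}"
    then obtain e where "e \<in> edges_between H' (L' u) (L' v)" by auto
    then have "edges_between H (L u) (L v) \<noteq> {}" using betw(1) uv by blast
    then show "{u, v} \<in> edges G" using cov uv unfolding two_fold_cover_def by blast
  next
    fix u v assume uv: "u \<in> ?V" "v \<in> ?V" "{u, v} \<in> edges G"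
    then have dis: "disjoint (edges_between H (L u) (L v))"
      using cov by (auto simp: two_fold_cover_def)
    show "disjoint (edges_between H' (L' u) (L' v))"
    proof (rule disjointI)
      fix a b
      assume a: "a \<in> edges_between H' (L' u) (L' v)" and b: "b \<in> edges_between H' (L' u) (L' v)"
        and "a \<noteq> b"
      then have "g ` a \<noteq> g ` b"
        using inj_img betw(2)[OF a uv(1,2)] betw(2)[OF b uv(1,2)] by (meson PowI inj_onD)
      then have "g ` a \<inter> g ` b = {}"
        using disjointD[OF dis] betw(1)[OF a uv(1,2)] betw(1)[OF b uv(1,2)] by blast
      then show "a \<inter> b = {}" by auto
    qed
  qed
  moreover have "poor_rich G L' p' r'"
    by (auto simp: poor_rich_def L'_def p'_def r'_def)
  ultimately obtain \<phi>' where \<phi>': "cover_coloring G c L' H' p' r' \<phi>'"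
    using col unfolding colorable_def by blast
  define \<phi> where "\<phi> = (\<lambda>u. g (\<phi>' u))"
  have \<phi>'L: "\<phi>' u \<in> L' u" if "u \<in> ?V" for u
    using \<phi>' that by (auto simp: cover_coloring_def cover_map_def)
  have sub: "\<phi>' ` ?V \<subseteq> ?V \<times> UNIV" using \<phi>'L L'V by blast
  have deg: "degree (induced H (\<phi> ` ?V)) (\<phi> u) \<le> degree (induced H' (\<phi>' ` ?V)) (\<phi>' u)"
    if u: "u \<in> ?V" for u
  proof -
    let ?A = "{e \<in> edges (induced H (\<phi> ` ?V)). \<phi> u \<in> e}"
    let ?B = "{e \<in> edges (induced H' (\<phi>' ` ?V)). \<phi>' u \<in> e}"
    have fin: "finite ?B"
      using sg by (auto simp: induced_def simple_graph_def intro: finite_subset[of _ "Pow (\<phi>' ` ?V)"])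
    have "?A \<subseteq> image g ` ?B"
    proof
      fix e assume e: "e \<in> ?A"
      then have "e \<subseteq> g ` (\<phi>' ` ?V)" by (auto simp: induced_def \<phi>_def)
      then obtain e' where e': "e' \<subseteq> \<phi>' ` ?V" "e = g ` e'" by (meson subset_imageE)
      have "g (\<phi>' u) \<in> g ` e'" using e e'(2) by (simp add: \<phi>_def)
      moreover have "\<phi>' u \<in> ?V \<times> UNIV" "e' \<subseteq> ?V \<times> UNIV" using sub u e'(1) by auto
      ultimately have "\<phi>' u \<in> e'" using inj by (meson inj_on_image_mem_iff)
      then have "e' \<in> ?B" using e e' sub by (auto simp: induced_def H'_def)
      then show "e \<in> image g ` ?B" using e'(2) by blast
    qed
    then have "card ?A \<le> card ?B" using fin by (meson card_image_le card_mono finite_imageI le_trans)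
    then show ?thesis by (simp add: degree_def)
  qed
  have "cover_coloring G c L H p r \<phi>"
    unfolding cover_coloring_def
  proof (intro conjI ballI impI)
    show "cover_map G L \<phi>"
      using \<phi>'L gL' by (auto simp: cover_map_def \<phi>_def)
  next
    fix u assume u: "u \<in> ?V" and "\<phi> u = p u"
    then have "\<phi>' u = p' u"
      using \<phi>'L[OF u] ne[OF u] by (auto simp: \<phi>_def g_def p'_def L'_def split: if_splits)
    then have "int (degree (induced H' (\<phi>' ` ?V)) (\<phi>' u)) \<le> fst (c u)"
      using \<phi>' u by (auto simp: cover_coloring_def)
    then show "int (degree (induced H (\<phi> ` ?V)) (\<phi> u)) \<le> fst (c u)" using deg[OF u] by linarith
  next
    fix u assume u: "u \<in> ?V" and "\<phi> u = r u"
    then have "\<phi>' u = r' u"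
      using \<phi>'L[OF u] ne[OF u] by (auto simp: \<phi>_def g_def r'_def L'_def split: if_splits)
    then have "int (degree (induced H' (\<phi>' ` ?V)) (\<phi>' u)) \<le> snd (c u)"
      using \<phi>' u by (auto simp: cover_coloring_def)
    then show "int (degree (induced H (\<phi> ` ?V)) (\<phi> u)) \<le> snd (c u)" using deg[OF u] by linarith
  qed
  then show ?thesis by blast
qed

end

theory Submission
  imports Defs
begin

text \<open>Suppose that every vertex set has potential at least \<open>i - j\<close>; then \<open>G\<close> is colorable. Split
  the \<open>i + 1\<close> units of each edge between its two ends. By max-flow duality this can be done so that
  the loads of the vertices exceed their potentials by at most \<open>j - i\<close> in total. Call an edge owned
  by an end that carries all its units, and shared if both ends carry some. Moving single units
  around, one can achieve that overfull vertices own nothing, that other vertices own at most one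
  edge, and that the owned edges form a forest. Let every owner avoid the vertex at the other end
  of its owned edge. Then only shared edges cause conflicts, and their number at a vertex is at most
  its load. This suffices for owners in either state, and for the vertices that own nothing it leaves
  few exceptions to the rich state, namely overfull ones, which are settled by increasing excess.\<close>

section \<open>Simple directed paths as lists of vertices\<close>

fun arcs :: "'a list \<Rightarrow> ('a \<times> 'a) set" where
  "arcs (a # b # xs) = insert (a, b) (arcs (b # xs))"
| "arcs _ = {}"

lemma arcs_subset: "arcs xs \<subseteq> set xs \<times> set (tl xs)"
  by (induction xs rule: arcs.induct) auto

lemma arcs_suffix: "arcs zs \<subseteq> arcs (ys @ zs)"
proof (induction ys)
  case (Cons a ys)
  have "arcs xs \<subseteq> arcs (a # xs)" for xs by (cases xs) auto
  then show ?case using Cons by auto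
qed simp

lemma finite_arcs: "finite (arcs xs)"
  by (induction xs rule: arcs.induct) auto

lemma card_arcs: "distinct xs \<Longrightarrow> card (arcs xs) = length xs - 1"
proof (induction xs rule: arcs.induct)
  case (1 a b xs)
  have "(a, b) \<notin> arcs (b # xs)" using 1(2) arcs_subset[of "b # xs"] by auto
  then show ?case using 1 by (simp add: finite_arcs)
qed auto

text \<open>A path is extended at its front; if the new first vertex already occurs on it,
  everything before that occurrence is cut off. Distinctness is what allows units to be pushed along
  the arcs independently.\<close>

lemma simple_path:
  assumes "(u, w) \<in> R\<^sup>*"
  shows "\<exists>xs. xs \<noteq> [] \<and> hd xs = u \<and> last xs = w \<and> distinct xs \<and> arcs xs \<subseteq> R"
  using assms
proof (induction rule: converse_rtrancl_induct)
  case base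
  show ?case by (rule exI[of _ "[w]"]) simp
next
  case (step u b)
  then obtain xs where xs: "xs \<noteq> []" "hd xs = b" "last xs = w" "distinct xs" "arcs xs \<subseteq> R"
    by blast
  show ?case
  proof (cases "u \<in> set xs")
    case True
    then obtain ys zs where "xs = ys @ u # zs" by (meson split_list)
    then show ?thesis using xs arcs_suffix[of "u # zs" ys]
      by (intro exI[of _ "u # zs"]) auto
  next
    case False
    then show ?thesis using xs step(1)
      by (intro exI[of _ "u # xs"]) (cases xs; auto)
  qed
qed


section \<open>Splitting the edges of a graph\<close>

text \<open>\<open>A\<close> holds both orientations of every edge, and \<open>d\<close> is the
  number of units of an edge. With \<open>d \<ge> 2\<close>, an owned edge that gives up one unit
  becomes shared instead of owned from the other end.\<close>

locale split_graph =
  fixes V :: "'a set" and A :: "('a \<times> 'a) set" and d :: int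
  assumes finV: "finite V" and AV: "A \<subseteq> V \<times> V" and symA: "sym A" and irreflA: "irrefl A"
    and d2: "d \<ge> 2"
begin

text \<open>\<open>f a b\<close> counts the units of the edge \<open>ab\<close> carried by
  \<open>a\<close>, so a positive value means that a unit can move from \<open>a\<close> to
  \<open>b\<close>.\<close>

definition splitting :: "('a \<Rightarrow> 'a \<Rightarrow> int) \<Rightarrow> bool" where
  "splitting f \<longleftrightarrow> (\<forall>a b. 0 \<le> f a b) \<and> (\<forall>a b. (a, b) \<in> A \<longrightarrow> f a b + f b a = d) \<and>
     (\<forall>a b. (a, b) \<notin> A \<longrightarrow> f a b = 0)"

definition load :: "('a \<Rightarrow> 'a \<Rightarrow> int) \<Rightarrow> 'a \<Rightarrow> int" where
  "load f v = (\<Sum>w\<in>V. f v w)"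

definition owned :: "('a \<Rightarrow> 'a \<Rightarrow> int) \<Rightarrow> ('a \<times> 'a) set" where
  "owned f = {(a, b). f a b = d}"

definition shared :: "('a \<Rightarrow> 'a \<Rightarrow> int) \<Rightarrow> 'a \<Rightarrow> 'a set" where
  "shared f v = {w. 0 < f v w \<and> f v w < d}"

definition shift :: "'a \<Rightarrow> 'a \<Rightarrow> ('a \<Rightarrow> 'a \<Rightarrow> int) \<Rightarrow> 'a \<Rightarrow> 'a \<Rightarrow> int" where
  "shift a b f = (\<lambda>u v. f u v - of_bool (u = a \<and> v = b) + of_bool (u = b \<and> v = a))"

lemma splittingD:
  assumes "splitting f"
  shows "0 \<le> f a b" "(a, b) \<in> A \<Longrightarrow> f a b + f b a = d" "f a b \<noteq> 0 \<Longrightarrow> (a, b) \<in> A"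
  using assms by (auto simp: splitting_def)

lemma pos_arc:
  assumes "splitting f" "f a b > 0"
  shows "(a, b) \<in> A" "(b, a) \<in> A" "a \<in> V" "b \<in> V" "a \<noteq> b" "f a b + f b a = d"
proof -
  show ab: "(a, b) \<in> A" using splittingD(3)[OF assms(1)] assms(2) by fastforce
  show "(b, a) \<in> A" using ab symA by (meson symD)
  show "a \<in> V" "b \<in> V" using ab AV by auto
  show "a \<noteq> b" using ab irreflA by (auto simp: irrefl_def)
  show "f a b + f b a = d" using splittingD(2)[OF assms(1) ab] .
qed

lemma splitting_shift:
  assumes "splitting f" "f a b > 0"
  shows "splitting (shift a b f)"
  using assms pos_arc[OF assms] unfolding splitting_def shift_def
  by (smt (verit) of_bool_eq)

lemma load_shift:
  assumes "splitting f" "f a b > 0"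
  shows "load (shift a b f) v = load f v - of_bool (v = a) + of_bool (v = b)"
proof -
  note ab = pos_arc[OF assms]
  have "load (shift a b f) v
      = load f v - (\<Sum>w\<in>V. of_bool (v = a \<and> w = b)) + (\<Sum>w\<in>V. of_bool (v = b \<and> w = a))"
    by (simp add: load_def shift_def sum.distrib sum_subtractf)
  also have "(\<Sum>w\<in>V. of_bool (v = a \<and> w = b)) = (of_bool (v = a) :: int)"
    using ab finV by (cases "v = a") (simp_all add: of_bool_def)
  also have "(\<Sum>w\<in>V. of_bool (v = b \<and> w = a)) = (of_bool (v = b) :: int)"
    using ab finV by (cases "v = b") (simp_all add: of_bool_def)
  finally show ?thesis .
qed

text \<open>Every inner vertex receives one unit and passes one on, so only the loads of the two
  ends change.\<close>

lemma push_path: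
  assumes "splitting f" "distinct xs" "xs \<noteq> []" "arcs xs \<subseteq> {(a, b). 0 < f a b}"
  shows "\<exists>g. splitting g \<and>
    (\<forall>v. load g v = load f v - of_bool (v = hd xs) + of_bool (v = last xs)) \<and>
    (\<forall>u v. g u v = f u v - of_bool ((u, v) \<in> arcs xs) + of_bool ((v, u) \<in> arcs xs))"
  using assms
proof (induction xs rule: arcs.induct)
  case (1 a b xs)
  then obtain g where g: "splitting g"
    "\<And>v. load g v = load f v - of_bool (v = b) + of_bool (v = last (b # xs))"
    "\<And>u v. g u v = f u v - of_bool ((u, v) \<in> arcs (b # xs)) + of_bool ((v, u) \<in> arcs (b # xs))"
    by auto
  \<comment> \<open>The tail is pushed first. As \<open>a\<close> does not lie on it, the first arc
    keeps its positive value in the meantime.\<close>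
  have nin: "(a, y) \<notin> arcs (b # xs)" "(y, a) \<notin> arcs (b # xs)" for y
    using arcs_subset[of "b # xs"] 1(3) by auto
  then have "g a b = f a b" using g(3) by simp
  then have pos: "g a b > 0" using 1(5) by auto
  have "load (shift a b g) v = load f v - of_bool (v = a) + of_bool (v = last (b # xs))" for v
    using load_shift[OF g(1) pos] g(2) by simp
  moreover have "shift a b g u v = f u v - of_bool ((u, v) \<in> arcs (a # b # xs))
      + of_bool ((v, u) \<in> arcs (a # b # xs))" for u v
    using g(3)[of u v] nin 1(3) by (auto simp: shift_def)
  ultimately show ?case using splitting_shift[OF g(1) pos] by (metis last_ConsR list.distinct(1) list.sel(1))
qed auto

text \<open>An injective numbering decides each edge: the end with the smaller number carries all
  units.\<close>

lemma splitting_exists: "\<exists>f. splitting f"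
proof -
  obtain h :: "'a \<Rightarrow> nat" where h: "inj_on h V"
    using finite_imp_inj_to_nat_seg[OF finV] by blast
  have "splitting (\<lambda>a b. if (a, b) \<in> A \<and> h a < h b then d else 0)"
    unfolding splitting_def
  proof (intro conjI allI impI)
    fix a b assume ab: "(a, b) \<in> A"
    then have "a \<noteq> b" "a \<in> V" "b \<in> V" "(b, a) \<in> A"
      using irreflA AV symA by (auto simp: irrefl_def dest: symD)
    then have "h a \<noteq> h b" using h by (auto dest: inj_onD)
    then show "(if (a, b) \<in> A \<and> h a < h b then d else 0)
      + (if (b, a) \<in> A \<and> h b < h a then d else 0) = d"
      using ab \<open>(b, a) \<in> A\<close> by auto
  qed (use d2 in auto)
  then show ?thesis by blast
qed

text \<open>Adding the double sum to its transpose collects \<open>d\<close> for every ordered pair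
  in \<open>A\<close>, and each edge gives two such pairs.\<close>

lemma sum_splitting:
  assumes "splitting f" "S \<subseteq> V"
  shows "2 * (\<Sum>v\<in>S. \<Sum>w\<in>S. f v w) = d * int (card (A \<inter> S \<times> S))"
proof -
  have fS: "finite S" using assms(2) finV finite_subset by blast
  have "2 * (\<Sum>v\<in>S. \<Sum>w\<in>S. f v w) = (\<Sum>v\<in>S. \<Sum>w\<in>S. f v w) + (\<Sum>v\<in>S. \<Sum>w\<in>S. f w v)"
    using sum.swap[of "\<lambda>v w. f w v" S S] by simp
  also have "\<dots> = (\<Sum>v\<in>S. \<Sum>w\<in>S. f v w + f w v)" by (simp add: sum.distrib)
  also have "\<dots> = (\<Sum>v\<in>S. \<Sum>w\<in>S. d * of_bool ((v, w) \<in> A))"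
  proof (intro sum.cong refl)
    fix v w show "f v w + f w v = d * of_bool ((v, w) \<in> A)"
      using assms(1) symD[OF symA, of v w] symD[OF symA, of w v]
      by (cases "(v, w) \<in> A"; cases "(w, v) \<in> A") (auto simp: splitting_def)
  qed
  also have "\<dots> = d * (\<Sum>z\<in>S \<times> S. of_bool (z \<in> A))"
    by (simp add: sum.cartesian_product sum_distrib_left case_prod_unfold)
  also have "(\<Sum>z\<in>S \<times> S. of_bool (z \<in> A)) = int (card (A \<inter> S \<times> S))"
    using fS by (simp add: of_bool_def sum.If_cases Int_commute)
  finally show ?thesis .
qed

section \<open>Minimising the total excess\<close>

definition excess :: "('a \<Rightarrow> int) \<Rightarrow> ('a \<Rightarrow> 'a \<Rightarrow> int) \<Rightarrow> 'a \<Rightarrow> int" where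
  "excess \<rho> f v = max 0 (load f v - \<rho> v)"

lemma excess_nonneg: "0 \<le> excess \<rho> f v"
  by (simp add: excess_def)

text \<open>The set of vertices reachable from the overfull ones along arcs of positive value attains
  equality in the hypothesis, because no unit can be moved out of it.\<close>

lemma small_excess:
  assumes B: "\<And>S. S \<subseteq> V \<Longrightarrow> d * int (card (A \<inter> S \<times> S)) \<le> 2 * (B + (\<Sum>v\<in>S. \<rho> v))"
  shows "\<exists>f. splitting f \<and> (\<Sum>v\<in>V. excess \<rho> f v) \<le> B"
proof -
  define X where "X f = (\<Sum>v\<in>V. excess \<rho> f v)" for f
  have X0: "0 \<le> X f" for f by (simp add: X_def sum_nonneg excess_nonneg)
  obtain f where f: "splitting f" and fmin: "\<And>g. splitting g \<Longrightarrow> nat (X f) \<le> nat (X g)"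
    using splitting_exists ex_has_least_nat[of splitting _ "\<lambda>f. nat (X f)"] by blast
  define R where "R = {(a, b). 0 < f a b}"
  define S where "S = {w \<in> V. \<exists>u\<in>V. \<rho> u < load f u \<and> (u, w) \<in> R\<^sup>*}"
  have SV: "S \<subseteq> V" and fS: "finite S" using finV by (auto simp: S_def)
  \<comment> \<open>A vertex of \<open>S\<close> below its potential could absorb a unit pushed from
    an overfull vertex, which would lower the total excess by one.\<close>
  have full: "\<rho> w \<le> load f w" if wS: "w \<in> S" for w
  proof (rule ccontr)
    assume lt: "\<not> \<rho> w \<le> load f w"
    from wS obtain u where u: "u \<in> V" "\<rho> u < load f u" "(u, w) \<in> R\<^sup>*" and w: "w \<in> V"
      by (auto simp: S_def)
    obtain xs where xs: "xs \<noteq> []" "hd xs = u" "last xs = w" "distinct xs" "arcs xs \<subseteq> R"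
      using simple_path[OF u(3)] by blast
    obtain g where g: "splitting g"
      "\<And>v. load g v = load f v - of_bool (v = u) + of_bool (v = w)"
      using push_path[OF f xs(4,1)] xs(2,3,5) unfolding R_def by blast
    have uw: "u \<noteq> w" using u(2) lt by auto
    have "excess \<rho> g v \<le> excess \<rho> f v - of_bool (v = u)" for v
      using uw lt u(2) by (auto simp: excess_def g(2))
    then have "X g \<le> (\<Sum>v\<in>V. excess \<rho> f v - of_bool (v = u))"
      unfolding X_def by (intro sum_mono)
    also have "\<dots> = X f - 1" using u(1) finV by (simp add: X_def sum_subtractf of_bool_def)
    finally show False using fmin[OF g(1)] X0[of g] by linarith
  qed
  have zero: "f v w = 0" if "v \<in> S" "w \<in> V - S" for v w
  proof (rule ccontr)
    assume "f v w \<noteq> 0"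
    then have "(v, w) \<in> R" using splittingD(1)[OF f, of v w] by (simp add: R_def)
    then show False using that unfolding S_def by (auto intro: rtrancl_into_rtrancl)
  qed
  \<comment> \<open>No vertex outside \<open>S\<close> has excess, and by \<open>zero\<close> the
    loads in \<open>S\<close> come from edges inside \<open>S\<close> alone. So the excess is
    computed by counting these edges.\<close>
  have "X f = (\<Sum>v\<in>S. excess \<rho> f v)"
    unfolding X_def
  proof (rule sum.mono_neutral_right[OF finV SV], intro ballI)
    fix v assume "v \<in> V - S"
    then have "\<not> \<rho> v < load f v" by (auto simp: S_def)
    then show "excess \<rho> f v = 0" by (simp add: excess_def)
  qed
  also have "\<dots> = (\<Sum>v\<in>S. load f v) - (\<Sum>v\<in>S. \<rho> v)"
    using full by (simp add: excess_def sum_subtractf[symmetric])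
  also have "(\<Sum>v\<in>S. load f v) = (\<Sum>v\<in>S. \<Sum>w\<in>S. f v w)"
    unfolding load_def using zero
    by (intro sum.cong refl sum.mono_neutral_right[OF finV SV]) auto
  finally have "2 * X f = d * int (card (A \<inter> S \<times> S)) - 2 * (\<Sum>v\<in>S. \<rho> v)"
    using sum_splitting[OF f SV] by simp
  then have "X f \<le> B" using B[OF SV] by simp
  then show ?thesis using f X_def by auto
qed

section \<open>Owned and shared edges\<close>

lemma owned_arc:
  assumes "splitting f" "(a, b) \<in> owned f"
  shows "a \<in> V" "b \<in> V" "a \<noteq> b" "f a b = d" "f b a = 0"
  using pos_arc[OF assms(1), of a b] assms(2) d2 by (auto simp: owned_def)

lemma finite_owned: "splitting f \<Longrightarrow> finite (owned f)"
  using owned_arc(1,2) finV by (meson finite_SigmaI finite_subset mem_Sigma_iff subrelI)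

lemma finite_shared: "splitting f \<Longrightarrow> finite (shared f v)"
  by (rule finite_subset[OF _ finV]) (use pos_arc in \<open>auto simp: shared_def\<close>)

text \<open>Moves one unit from \<open>v\<close> to its neighbour \<open>w\<close>, and on along owned arcs to \<open>t\<close>. Passing
  a unit along an owned arc turns it into a shared one, so no other ownership is created.\<close>

lemma reroute:
  assumes f: "splitting f" and vw: "0 < f v w" and wt: "(w, t) \<in> (owned f)\<^sup>*"
    and nv: "(v, w) \<in> owned f \<or> w \<in> shared f v"
  shows "\<exists>g xs. splitting g \<and> (\<forall>u. load g u = load f u - of_bool (u = v) + of_bool (u = t)) \<and>
    xs \<noteq> [] \<and> hd xs = w \<and> last xs = t \<and> distinct xs \<and> arcs xs \<subseteq> owned f \<and>
    owned g \<subseteq> owned f - arcs xs - {(v, w)} \<union> (if w \<in> shared f v then {(w, v)} else {})"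
proof -
  obtain xs where xs: "xs \<noteq> []" "hd xs = w" "last xs = t" "distinct xs" "arcs xs \<subseteq> owned f"
    using simple_path[OF wt] by blast
  have sub: "arcs xs \<subseteq> {(a, b). 0 < f a b}" using xs(5) d2 by (auto simp: owned_def)
  obtain g where g: "splitting g"
    "\<And>u. load g u = load f u - of_bool (u = w) + of_bool (u = t)"
    "\<And>a b. g a b = f a b - of_bool ((a, b) \<in> arcs xs) + of_bool ((b, a) \<in> arcs xs)"
    using push_path[OF f xs(4,1) sub] xs(2,3) by metis
  have "w \<notin> set (tl xs)" using xs(1,2,4) by (cases xs) auto
  then have n1: "(v, w) \<notin> arcs xs" using arcs_subset[of xs] by auto
  have n2: "(w, v) \<notin> arcs xs"
  proof
    assume "(w, v) \<in> arcs xs"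
    then have "f w v = d" "f v w = 0" using xs(5) owned_arc[OF f, of w v] by auto
    then show False using vw by simp
  qed
  have gvw: "g v w = f v w" "g w v = f w v" using g(3) n1 n2 by simp_all
  then have pos: "0 < g v w" using vw by simp
  have "load (shift v w g) u = load f u - of_bool (u = v) + of_bool (u = t)" for u
    using load_shift[OF g(1) pos] g(2) by simp
  moreover have "owned (shift v w g)
      \<subseteq> owned f - arcs xs - {(v, w)} \<union> (if w \<in> shared f v then {(w, v)} else {})"
  proof (rule subrelI)
    fix a b assume "(a, b) \<in> owned (shift v w g)"
    then have ab: "shift v w g a b = d" by (simp add: owned_def)
    have vne: "v \<noteq> w" using pos_arc[OF f vw] by simp
    have le: "f a b \<le> d" for a b
      using splittingD(1)[OF f, of b a] splittingD(2,3)[OF f, of a b] d2 by fastforce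
    consider "a = v" "b = w" | "a = w" "b = v" | "(a, b) \<noteq> (v, w)" "(a, b) \<noteq> (w, v)" by blast
    then show "(a, b) \<in> owned f - arcs xs - {(v, w)} \<union> (if w \<in> shared f v then {(w, v)} else {})"
    proof cases
      case 1
      then have "f v w - 1 = d" using ab vne gvw by (simp add: shift_def)
      then show ?thesis using le[of v w] by simp
    next
      \<comment> \<open>The arc \<open>(w, v)\<close> becomes owned only if \<open>w\<close> carried
        \<open>d - 1\<close> units before. If \<open>(v, w)\<close> were owned, this number would be
        0, against \<open>d \<ge> 2\<close>; hence the edge was shared.\<close>
      case 2
      then have "f w v + 1 = d" using ab vne gvw by (simp add: shift_def)
      then have "(v, w) \<notin> owned f" using pos_arc(6)[OF f vw] d2 by (auto simp: owned_def)
      then show ?thesis using nv 2 by simp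
    next
      case 3
      \<comment> \<open>An arc of the path has lost a unit, and its reverse has risen from 0 to 1,
        which is below \<open>d\<close>. All other arcs keep their values.\<close>
      then have gab: "g a b = d" using ab by (auto simp: shift_def)
      have "(a, b) \<notin> arcs xs"
      proof
        assume m: "(a, b) \<in> arcs xs"
        then have "(b, a) \<notin> arcs xs"
          using xs(5) owned_arc(4,5)[OF f] d2 by (metis subsetD not_numeral_le_zero)
        then have "g a b = f a b - 1" using g(3) m by simp
        then show False using gab le[of a b] by simp
      qed
      moreover have "(b, a) \<notin> arcs xs"
      proof
        assume "(b, a) \<in> arcs xs"
        then have "f a b = 0" using xs(5) owned_arc(5)[OF f] by blast
        then show False using gab g(3)[of a b] d2 by (simp add: of_bool_def split: if_splits)
      qed
      ultimately show ?thesis using gab g(3)[of a b] 3 by (auto simp: owned_def)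
    qed
  qed
  ultimately show ?thesis using splitting_shift[OF g(1) pos] xs by blast
qed

text \<open>The extremal splitting minimises the number of owned arcs and, subject to that, maximises the
  sum of the squares of the excesses.\<close>

lemma good_splitting:
  assumes B: "\<And>S. S \<subseteq> V \<Longrightarrow> d * int (card (A \<inter> S \<times> S)) \<le> 2 * (B + (\<Sum>v\<in>S. \<rho> v))"
    and \<rho>: "\<And>v. v \<in> V \<Longrightarrow> \<rho> v < 2 * d"
  obtains f where "splitting f" "(\<Sum>v\<in>V. excess \<rho> f v) \<le> B"
    and "\<And>v w. (v, w) \<in> owned f \<Longrightarrow> load f v \<le> \<rho> v"
    and "single_valued (owned f)" and "acyclic (owned f)"
    and "\<And>v w t. \<lbrakk>w \<in> shared f v; (w, t) \<in> (owned f)\<^sup>+; \<rho> v < load f v; \<rho> t < load f t\<rbrakk>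
           \<Longrightarrow> load f t - \<rho> t < load f v - \<rho> v"
proof -
  define P where "P f \<longleftrightarrow> splitting f \<and> (\<Sum>v\<in>V. excess \<rho> f v) \<le> B" for f
  define Q where "Q f = nat (\<Sum>v\<in>V. (excess \<rho> f v)\<^sup>2)" for f
  \<comment> \<open>\<open>m\<close> encodes the lexicographic order. Nonnegative excesses of sum at
    most \<open>B\<close> have squares of sum at most \<open>B * B\<close>, so \<open>Q\<close>
    stays below \<open>K\<close> and cannot outweigh one owned arc.\<close>
  define K where "K = nat B * nat B + 1"
  define m where "m f = card (owned f) * K + (K - Suc (Q f))" for f
  obtain f where Pf: "P f" and fmin: "\<And>g. P g \<Longrightarrow> m f \<le> m g"
    using small_excess[OF B] ex_has_least_nat[of P _ m] unfolding P_def by blast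
  have f: "splitting f" and XB: "(\<Sum>v\<in>V. excess \<rho> f v) \<le> B" using Pf by (auto simp: P_def)
  have QK: "Q g < K" if "P g" for g
  proof -
    have XgB: "(\<Sum>v\<in>V. excess \<rho> g v) \<le> B" using that by (simp add: P_def)
    then have B0: "0 \<le> B" using sum_nonneg[of V "excess \<rho> g"] excess_nonneg by fastforce
    have "(\<Sum>v\<in>V. (excess \<rho> g v)\<^sup>2) \<le> (\<Sum>v\<in>V. excess \<rho> g v * B)"
    proof (rule sum_mono)
      fix v assume "v \<in> V"
      then have "excess \<rho> g v \<le> (\<Sum>v\<in>V. excess \<rho> g v)"
        using finV excess_nonneg by (intro member_le_sum) auto
      then show "(excess \<rho> g v)\<^sup>2 \<le> excess \<rho> g v * B"
        unfolding power2_eq_square using XgB excess_nonneg by (intro mult_left_mono) auto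
    qed
    also have "\<dots> \<le> B * B"
      unfolding sum_distrib_right[symmetric] using XgB B0 by (intro mult_right_mono)
    finally have "nat (\<Sum>v\<in>V. (excess \<rho> g v)\<^sup>2) \<le> nat (B * B)" by (rule nat_mono)
    then show ?thesis using B0 by (simp add: Q_def K_def nat_mult_distrib)
  qed
  have min1: False if "P g" "card (owned g) < card (owned f)" for g
  proof -
    have "m g < (card (owned g) + 1) * K" using QK[OF that(1)] by (simp add: m_def)
    also have "\<dots> \<le> card (owned f) * K" using that(2) by (intro mult_right_mono) auto
    also have "\<dots> \<le> m f" by (simp add: m_def)
    finally show False using fmin[OF that(1)] by simp
  qed
  have min2: False if "P g" "card (owned g) \<le> card (owned f)" "Q f < Q g" for g
  proof -
    have "card (owned g) * K \<le> card (owned f) * K" using that(2) by (rule mult_right_mono) simp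
    moreover have "K - Suc (Q g) < K - Suc (Q f)" using that(3) QK[OF that(1)] by linarith
    ultimately show False using fmin[OF that(1)] unfolding m_def by linarith
  qed
  have fewer: "card (owned g) < card (owned f)"
    if "(v, w) \<in> owned f" "owned g \<subseteq> owned f - E - {(v, w)}" for g v w E
    using that finite_owned[OF f] by (intro psubset_card_mono) auto
  \<comment> \<open>Taking a unit from an overfull \<open>v\<close> lowers its excess by one, and
    \<open>t\<close> gains at most one; for \<open>v = t\<close> no load changes.\<close>
  have PgI: "P g" if "splitting g" "v \<in> V" "t \<in> V" "\<rho> v < load f v \<or> v = t"
    "\<And>u. load g u = load f u - of_bool (u = v) + of_bool (u = t)" for g v t
  proof -
    have "excess \<rho> g u \<le> excess \<rho> f u - of_bool (u = v) + of_bool (u = t)" for u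
      using that(4) by (auto simp: excess_def that(5))
    then have "(\<Sum>u\<in>V. excess \<rho> g u)
        \<le> (\<Sum>u\<in>V. excess \<rho> f u - of_bool (u = v) + of_bool (u = t))"
      by (intro sum_mono)
    also have "\<dots> = (\<Sum>u\<in>V. excess \<rho> f u)"
      using that(2,3) finV by (simp add: sum.distrib sum_subtractf of_bool_def)
    finally show ?thesis using XB that(1) by (simp add: P_def)
  qed
  \<comment> \<open>An overfull owner could hand one unit to \<open>w\<close>: one owned arc is lost
    and none arises.\<close>
  have c1: "load f v \<le> \<rho> v" if vw: "(v, w) \<in> owned f" for v w
  proof (rule ccontr)
    assume lt: "\<not> load f v \<le> \<rho> v"
    note o = owned_arc[OF f vw]
    have pos: "0 < f v w" and ns: "w \<notin> shared f v" using o d2 by (simp_all add: shared_def)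
    obtain g xs where g: "splitting g"
      "\<And>u. load g u = load f u - of_bool (u = v) + of_bool (u = w)"
      "owned g \<subseteq> owned f - arcs xs - {(v, w)}"
      using reroute[OF f pos rtrancl_refl disjI1[OF vw]] ns by auto
    have "P g" by (rule PgI[OF g(1) o(1,2) _ g(2)]) (use lt in simp)
    then show False using min1 fewer[OF vw g(3)] by blast
  qed
  \<comment> \<open>Two owned edges would mean a load of at least \<open>2 * d\<close>, more than
    the potential, although owners are not overfull.\<close>
  have c2: "single_valued (owned f)"
  proof (rule single_valuedI)
    fix v a b assume va: "(v, a) \<in> owned f" and vb: "(v, b) \<in> owned f"
    note o = owned_arc[OF f va] owned_arc[OF f vb]
    show "a = b"
    proof (rule ccontr)
      assume ne: "a \<noteq> b"
      have "(\<Sum>w\<in>{a, b}. f v w) \<le> load f v"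
        unfolding load_def using o splittingD(1)[OF f] finV by (intro sum_mono2) auto
      then have "2 * d \<le> load f v" using ne o by simp
      then show False using c1[OF va] \<rho>[OF o(1)] by simp
    qed
  qed
  \<comment> \<open>Pushing a unit around a cycle of owned arcs preserves all loads and destroys
    ownership.\<close>
  have c3: "acyclic (owned f)"
  proof (rule acyclicI, intro allI notI)
    fix v assume "(v, v) \<in> (owned f)\<^sup>+"
    then obtain w where vw: "(v, w) \<in> owned f" and wv: "(w, v) \<in> (owned f)\<^sup>*"
      by (meson tranclD)
    note o = owned_arc[OF f vw]
    have pos: "0 < f v w" and ns: "w \<notin> shared f v" using o d2 by (simp_all add: shared_def)
    obtain g xs where g: "splitting g"
      "\<And>u. load g u = load f u - of_bool (u = v) + of_bool (u = v)"
      "owned g \<subseteq> owned f - arcs xs - {(v, w)}"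
      using reroute[OF f pos wv disjI1[OF vw]] ns by auto
    have "P g" by (rule PgI[OF g(1) o(1,1) _ g(2)]) simp
    then show False using min1 fewer[OF vw g(3)] by blast
  qed
  \<comment> \<open>Otherwise push a unit from \<open>v\<close> through \<open>w\<close> to
    \<open>t\<close>. The arc \<open>(w, v)\<close> may become owned, but every arc of the
    nontrivial path from \<open>w\<close> to \<open>t\<close> ceases to be.\<close>
  have c4: "load f t - \<rho> t < load f v - \<rho> v"
    if w: "w \<in> shared f v" and wt: "(w, t) \<in> (owned f)\<^sup>+"
      and v: "\<rho> v < load f v" and t: "\<rho> t < load f t" for v w t
  proof (rule ccontr)
    assume neg: "\<not> load f t - \<rho> t < load f v - \<rho> v"
    have vw: "0 < f v w" "f v w < d" using w by (auto simp: shared_def)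
    have vV: "v \<in> V" using pos_arc[OF f vw(1)] by simp
    have tV: "t \<in> V" using wt owned_arc[OF f] by (meson tranclD2)
    obtain g xs where g: "splitting g"
      "\<And>u. load g u = load f u - of_bool (u = v) + of_bool (u = t)"
      and xs: "xs \<noteq> []" "hd xs = w" "last xs = t" "distinct xs" "arcs xs \<subseteq> owned f"
      and og: "owned g \<subseteq> owned f - arcs xs - {(v, w)} \<union> {(w, v)}"
      using reroute[OF f vw(1) trancl_into_rtrancl[OF wt]] w by auto
    have Pg: "P g" by (rule PgI[OF g(1) vV tV _ g(2)]) (use v in simp)
    have wt_ne: "w \<noteq> t" using wt c3 by (auto simp: acyclic_def)
    have "card (owned g) \<le> card (insert (w, v) (owned f - arcs xs))"
      using og finite_owned[OF f] by (intro card_mono) auto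
    also have "\<dots> \<le> Suc (card (owned f - arcs xs))" by (rule card_insert_le_m1) auto
    also have "\<dots> = Suc (card (owned f) - (length xs - 1))"
      using card_Diff_subset[OF finite_arcs xs(5)] card_arcs[OF xs(4)] by simp
    finally have cg: "card (owned g) \<le> Suc (card (owned f) - (length xs - 1))" .
    have lo: "length xs - 1 \<le> card (owned f)"
      using card_mono[OF finite_owned[OF f] xs(5)] xs(4) by (simp add: card_arcs)
    have l2: "2 \<le> length xs" using xs(1-3) wt_ne by (cases xs rule: arcs.cases) auto
    show False
    proof (cases "t = v")
      case True
      \<comment> \<open>A path of one arc would be \<open>(w, v)\<close>, which is shared. So at
        least two owned arcs are lost against one gained.\<close>
      have "length xs \<noteq> 2"
      proof
        assume "length xs = 2"
        then have "xs = [w, v]" using xs(2,3) True by (cases xs rule: arcs.cases) auto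
        then have "(w, v) \<in> owned f" using xs(5) by simp
        then show False using owned_arc[OF f] vw by fastforce
      qed
      then have "card (owned g) < card (owned f)" using cg lo l2 by linarith
      then show False using min1 Pg by blast
    next
      case False
      \<comment> \<open>The squares change in total by
        \<open>2 + 2 * (excess \<rho> f t - excess \<rho> f v)\<close>, which is positive if
        \<open>t\<close> has at least the excess of \<open>v\<close>.\<close>
      have "(excess \<rho> g u)\<^sup>2 = (excess \<rho> f u)\<^sup>2 + of_bool (u = v) * (1 - 2 * excess \<rho> f v)
          + of_bool (u = t) * (1 + 2 * excess \<rho> f t)" for u
        using v t False by (auto simp: excess_def g(2) power2_eq_square algebra_simps)
      then have "(\<Sum>u\<in>V. (excess \<rho> g u)\<^sup>2) = (\<Sum>u\<in>V. (excess \<rho> f u)\<^sup>2)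
          + (\<Sum>u\<in>V. of_bool (u = v) * (1 - 2 * excess \<rho> f v))
          + (\<Sum>u\<in>V. of_bool (u = t) * (1 + 2 * excess \<rho> f t))"
        by (simp only: sum.distrib)
      also have "\<dots> = (\<Sum>u\<in>V. (excess \<rho> f u)\<^sup>2) + (1 - 2 * excess \<rho> f v)
          + (1 + 2 * excess \<rho> f t)"
        unfolding sum_distrib_right[symmetric] using vV tV finV by (simp add: of_bool_def)
      also have "\<dots> > (\<Sum>u\<in>V. (excess \<rho> f u)\<^sup>2)" using neg v t by (simp add: excess_def)
      finally have "Q f < Q g" unfolding Q_def
        by (subst nat_less_eq_zless) (simp_all add: sum_nonneg)
      then show False using min2[OF Pg] cg lo l2 by linarith
    qed
  qed
  show thesis using that[OF f XB c1 c2 c3 c4] .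
qed

section \<open>Numbers of shared edges against loads\<close>

lemma sum_le_load:
  assumes "splitting f" "W \<subseteq> V"
  shows "(\<Sum>w\<in>W. f v w) \<le> load f v"
  unfolding load_def using assms finV splittingD(1) by (intro sum_mono2) auto

lemma card_le_sum:
  assumes "W \<subseteq> shared f v"
  shows "int (card W) \<le> (\<Sum>w\<in>W. f v w)"
proof -
  have "(\<Sum>w\<in>W. 1) \<le> (\<Sum>w\<in>W. f v w)"
    using assms by (intro sum_mono) (auto simp: shared_def)
  then show ?thesis by simp
qed

lemma shared_subset: "splitting f \<Longrightarrow> shared f v \<subseteq> V"
  using pos_arc(4) by (auto simp: shared_def)

lemma shared_sym:
  assumes "splitting f" "w \<in> shared f v"
  shows "v \<in> shared f w"
  using pos_arc(6)[OF assms(1), of v w] assms(2) by (auto simp: shared_def)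

lemma card_shared_le: "splitting f \<Longrightarrow> int (card (shared f v)) \<le> load f v"
  using card_le_sum[of "shared f v" f v] sum_le_load[of f "shared f v" v] shared_subset by fastforce

text \<open>The owned edge puts \<open>d\<close> units on \<open>v\<close>, and every shared edge at
  least one more.\<close>

lemma card_shared_owner:
  assumes f: "splitting f" and vw: "(v, w) \<in> owned f"
  shows "d + int (card (shared f v)) \<le> load f v"
proof -
  note o = owned_arc[OF f vw]
  have "(\<Sum>u\<in>insert w (shared f v). f v u) = d + (\<Sum>u\<in>shared f v. f v u)"
    using o finite_shared[OF f] by (subst sum.insert) (auto simp: shared_def)
  then show ?thesis
    using sum_le_load[OF f, of "insert w (shared f v)" v] o(2) shared_subset[OF f, of v]
      card_le_sum[of "shared f v" f v] by simp
qed

text \<open>The neighbour \<open>w\<close> is counted with its exact weight and every other one with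
  at least 1. Applied at both ends of a shared edge, the exact weights add up to
  \<open>d\<close>.\<close>

lemma card_shared_remove:
  assumes f: "splitting f" and w: "w \<in> shared f v"
  shows "f v w + int (card (shared f v)) - 1 \<le> load f v"
proof -
  have "f v w + int (card (shared f v - {w})) \<le> (\<Sum>u\<in>shared f v. f v u)"
    using card_le_sum[of "shared f v - {w}" f v] sum.remove[OF finite_shared[OF f] w, of "f v"] by simp
  moreover have "card (shared f v) > 0" using w finite_shared[OF f] card_gt_0_iff by blast
  ultimately show ?thesis
    using sum_le_load[OF f shared_subset[OF f], of v v] w finite_shared[OF f]
    by (simp add: of_nat_diff)
qed

end


section \<open>Choosing states from a splitting\<close>

text \<open>Here \<open>\<sigma>\<close> prescribes the states of the roots, and
  \<open>S \<sigma>\<close> extends them backwards along \<open>Q\<close>. Each other vertex has a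
  single successor, and by \<open>match\<close> at most one of its two states conflicts with the
  state of that successor. Hence a change at \<open>t\<close> is felt only by vertices that reach
  \<open>t\<close>.\<close>

lemma forest_states:
  fixes cf :: "'a \<Rightarrow> bool \<Rightarrow> 'a \<Rightarrow> bool \<Rightarrow> bool"
  assumes "finite Q" "acyclic Q" and sv: "single_valued Q"
    and match: "\<And>u a a' w b. \<lbrakk>cf u a w b; cf u a' w b\<rbrakk> \<Longrightarrow> a = a'"
  obtains S where "\<And>\<sigma> u. u \<notin> Domain Q \<Longrightarrow> S \<sigma> u = \<sigma> u"
    and "\<And>\<sigma> u w. (u, w) \<in> Q \<Longrightarrow> \<not> cf u (S \<sigma> u) w (S \<sigma> w)"
    and "\<And>\<sigma> t b u. (u, t) \<notin> Q\<^sup>* \<Longrightarrow> S (\<sigma>(t := b)) u = S \<sigma> u"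
proof -
  \<comment> \<open>The recursion at \<open>u\<close> calls the successor of \<open>u\<close>, so
    the converse of \<open>Q\<close> has to be well-founded.\<close>
  have wf: "wf (Q\<inverse>)" using assms(1,2) by (rule finite_acyclic_wf_converse)
  define av where "av u w b = (SOME a. \<not> cf u a w b)" for u w b
  have av: "\<not> cf u (av u w b) w b" for u w b
    unfolding av_def by (rule someI_ex) (use match in blast)
  define F where "F \<sigma> s u = (if u \<in> Domain Q then
      let w = (THE w. (u, w) \<in> Q) in av u w (s w) else \<sigma> u)" for \<sigma> s u
  define S where "S \<sigma> = wfrec (Q\<inverse>) (F \<sigma>)" for \<sigma>
  have top: "S \<sigma> u = \<sigma> u" if "u \<notin> Domain Q" for \<sigma> u
    unfolding S_def using that by (subst wfrec[OF wf]) (simp add: F_def)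
  have own: "S \<sigma> u = av u w (S \<sigma> w)" if uw: "(u, w) \<in> Q" for \<sigma> u w
  proof -
    have "(THE w. (u, w) \<in> Q) = w" using uw sv by (auto dest: single_valuedD)
    then show ?thesis
      unfolding S_def using uw
      by (subst wfrec[OF wf]) (auto simp: F_def cut_apply)
  qed
  have upd: "(u, t) \<notin> Q\<^sup>* \<longrightarrow> S (\<sigma>(t := b)) u = S \<sigma> u" for \<sigma> t b u
    using wf
  proof (induction u rule: wf_induct_rule)
    case (less u)
    show ?case
    proof (cases "u \<in> Domain Q")
      case True
      then obtain w where uw: "(u, w) \<in> Q" by auto
      show ?thesis
      proof
        assume "(u, t) \<notin> Q\<^sup>*"
        then have "(w, t) \<notin> Q\<^sup>*" using uw by (meson converse_rtrancl_into_rtrancl)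
        then have "S (\<sigma>(t := b)) w = S \<sigma> w" using less[of w] uw by blast
        then show "S (\<sigma>(t := b)) u = S \<sigma> u" by (simp only: own[OF uw])
      qed
    next
      case False
      then show ?thesis using top by auto
    qed
  qed
  have avoid: "\<not> cf u (S \<sigma> u) w (S \<sigma> w)" if "(u, w) \<in> Q" for \<sigma> u w
    unfolding own[OF that, of \<sigma>] by (rule av)
  show thesis using that[OF top avoid upd[rule_format]] .
qed

context split_graph
begin

text \<open>A vertex that owns an edge avoids the other end of it and can bear all its shared edges in
  either state (\<open>True\<close> is the poor one). A vertex that owns nothing is rich by default. The ones
  with too many shared edges for this are inspected by increasing excess: if such a \<open>t\<close> is
  overloaded as a rich vertex, it becomes poor. By the last property of \<open>good_splitting\<close> this
  affects no shared neighbour of a vertex inspected before, except possibly \<open>t\<close> itself.\<close>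

lemma defective_states:
  fixes c1 c2 :: "'a \<Rightarrow> int" and cf :: "'a \<Rightarrow> bool \<Rightarrow> 'a \<Rightarrow> bool \<Rightarrow> bool"
  assumes d: "d = i + 1" and ij: "2 * i + 1 \<le> j"
    and cap: "\<And>v. v \<in> V \<Longrightarrow> c1 v \<le> i \<and> c2 v \<le> j"
    and B: "\<And>S. S \<subseteq> V \<Longrightarrow>
      d * int (card (A \<inter> S \<times> S)) \<le> 2 * ((j - i) + (\<Sum>v\<in>S. i - j + 1 + c1 v + c2 v))"
    and sym: "\<And>u a w b. cf u a w b \<Longrightarrow> cf w b u a"
    and match: "\<And>u a a' w b. \<lbrakk>cf u a w b; cf u a' w b\<rbrakk> \<Longrightarrow> a = a'"
    and adj: "\<And>u a w b. cf u a w b \<Longrightarrow> (u, w) \<in> A"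
  shows "\<exists>s. \<forall>v\<in>V. int (card {w. cf v (s v) w (s w)}) \<le> (if s v then c1 v else c2 v)"
proof -
  define \<rho> where "\<rho> v = i - j + 1 + c1 v + c2 v" for v
  \<comment> \<open>The capacities give \<open>\<rho> v \<le> 2 * i + 1\<close>, one less than
    \<open>2 * d\<close>.\<close>
  have \<rho>d: "\<rho> v < 2 * d" if "v \<in> V" for v using cap[OF that] d by (simp add: \<rho>_def)
  have B': "d * int (card (A \<inter> S \<times> S)) \<le> 2 * ((j - i) + (\<Sum>v\<in>S. \<rho> v))" if "S \<subseteq> V" for S
    using B[OF that] by (simp add: \<rho>_def)
  obtain f where f: "splitting f" and X: "(\<Sum>v\<in>V. excess \<rho> f v) \<le> j - i"
    and owner: "\<And>v w. (v, w) \<in> owned f \<Longrightarrow> load f v \<le> \<rho> v"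
    and sv: "single_valued (owned f)" and ac: "acyclic (owned f)"
    and desc: "\<And>v w t. \<lbrakk>w \<in> shared f v; (w, t) \<in> (owned f)\<^sup>+; \<rho> v < load f v; \<rho> t < load f t\<rbrakk>
           \<Longrightarrow> load f t - \<rho> t < load f v - \<rho> v"
    using good_splitting[OF B' \<rho>d] by metis
  obtain S where top: "\<And>\<sigma> u. u \<notin> Domain (owned f) \<Longrightarrow> S \<sigma> u = \<sigma> u"
    and own: "\<And>\<sigma> u w. (u, w) \<in> owned f \<Longrightarrow> \<not> cf u (S \<sigma> u) w (S \<sigma> w)"
    and upd: "\<And>\<sigma> t b u. (u, t) \<notin> (owned f)\<^sup>* \<Longrightarrow> S (\<sigma>(t := b)) u = S \<sigma> u"
    using forest_states[OF finite_owned[OF f] ac sv, of cf] match by metis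
  define conf where "conf \<sigma> v = {w. cf v (S \<sigma> v) w (S \<sigma> w)}" for \<sigma> v
  define ok where "ok \<sigma> v \<longleftrightarrow> int (card (conf \<sigma> v)) \<le> (if S \<sigma> v then c1 v else c2 v)" for \<sigma> v
  have conf_shared: "conf \<sigma> v \<subseteq> shared f v" for \<sigma> v
  proof
    fix w assume "w \<in> conf \<sigma> v"
    then have c: "cf v (S \<sigma> v) w (S \<sigma> w)" by (simp add: conf_def)
    have "(v, w) \<notin> owned f" using own c by blast
    moreover have "(w, v) \<notin> owned f" using own sym[OF c] by blast
    moreover have "f v w + f w v = d" using splittingD(2)[OF f] adj[OF c] by simp
    ultimately show "w \<in> shared f v"
      using splittingD(1)[OF f, of v w] splittingD(1)[OF f, of w v]
      by (auto simp: owned_def shared_def)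
  qed
  have fin_conf: "finite (conf \<sigma> v)" for \<sigma> v
    using conf_shared finite_shared[OF f] by (rule finite_subset)
  have conf_le: "card (conf \<sigma> v) \<le> card (shared f v)" for \<sigma> v
    using conf_shared finite_shared[OF f] by (intro card_mono)
  define Sp where "Sp = {v \<in> V. v \<notin> Domain (owned f) \<and> c2 v < int (card (shared f v))}"
  \<comment> \<open>From \<open>c1 v \<le> i\<close> and \<open>j \<ge> 2 * i + 1\<close> follows
    \<open>\<rho> v \<le> c2 v\<close>, while the load is at least the number of shared
    edges.\<close>
  have over: "\<rho> v < load f v" if "v \<in> Sp" for v
    using that card_shared_le[OF f, of v] cap[of v] ij by (simp add: Sp_def \<rho>_def)
  \<comment> \<open>With more than \<open>c2 v\<close> conflicts in the rich state, this leaves at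
    most \<open>c1 v\<close> shared edges for the poor one.\<close>
  have few: "int (card (shared f v)) \<le> c1 v + c2 v + 1" if "v \<in> V" for v
  proof -
    have "excess \<rho> f v \<le> (\<Sum>v\<in>V. excess \<rho> f v)"
      using finV excess_nonneg that by (intro member_le_sum) auto
    then have "load f v \<le> \<rho> v + (j - i)" using X by (simp add: excess_def)
    then show ?thesis using card_shared_le[OF f, of v] by (simp add: \<rho>_def)
  qed
  \<comment> \<open>The excesses of \<open>v\<close> and \<open>t\<close> together are at most
    \<open>j - i\<close>, but their common edge alone adds \<open>d\<close> to the two loads. So
    \<open>t\<close> has at most one shared edge too many, and all of them are in conflict whenever
    \<open>t\<close> is overloaded as a rich vertex.\<close>
  have adj_special: "int (card (shared f t)) \<le> c2 t + 1"
    if "v \<in> Sp" "t \<in> Sp" "t \<in> shared f v" for v t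
  proof -
    have ne: "v \<noteq> t" and fd: "f v t + f t v = d"
      using pos_arc[OF f, of v t] that(3) by (auto simp: shared_def)
    have V: "v \<in> V" "t \<in> V" using that by (auto simp: Sp_def)
    have "(\<Sum>u\<in>{v, t}. excess \<rho> f u) \<le> (\<Sum>u\<in>V. excess \<rho> f u)"
      using finV V excess_nonneg by (intro sum_mono2) auto
    then have "load f v - \<rho> v + (load f t - \<rho> t) \<le> j - i" using ne X by (simp add: excess_def)
    moreover have "c2 v < int (card (shared f v))" using that(1) by (simp add: Sp_def)
    ultimately show ?thesis
      using card_shared_remove[OF f that(3)] card_shared_remove[OF f shared_sym[OF f that(3)]]
        fd cap[OF V(1)] cap[OF V(2)] d ij by (simp add: \<rho>_def)
  qed
  \<comment> \<open>The ranked induction inserts a \<open>t\<close> whose value of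
    \<open>load f t - \<rho> t\<close> is largest so far.\<close>
  have greedy: "T \<subseteq> Sp \<longrightarrow> (\<exists>\<sigma>. (\<forall>u. u \<notin> T \<longrightarrow> \<not> \<sigma> u) \<and> (\<forall>v\<in>T. ok \<sigma> v))" if "finite T" for T
    using that
  proof (induction T rule: finite_ranking_induct[where f = "\<lambda>v. load f v - \<rho> v", consumes 1])
    case empty
    show ?case by auto
  next
    case (insert t T)
    show ?case
    proof
      assume TSp: "insert t T \<subseteq> Sp"
      then obtain \<sigma> where \<sigma>: "\<And>u. u \<notin> T \<Longrightarrow> \<not> \<sigma> u" "\<And>v. v \<in> T \<Longrightarrow> ok \<sigma> v"
        using insert.IH by auto
      show "\<exists>\<sigma>. (\<forall>u. u \<notin> insert t T \<longrightarrow> \<not> \<sigma> u) \<and> (\<forall>v\<in>insert t T. ok \<sigma> v)"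
      proof (cases "ok \<sigma> t")
        case True
        then show ?thesis using \<sigma> by (intro exI[of _ \<sigma>]) auto
      next
        case False
        then have tT: "t \<notin> T" using \<sigma>(2) by blast
        have tSp: "t \<in> Sp" "t \<in> V" "t \<notin> Domain (owned f)" using TSp by (auto simp: Sp_def)
        have rich: "\<not> S \<sigma> t" using top[OF tSp(3)] \<sigma>(1)[OF tT] by simp
        then have many: "c2 t < int (card (conf \<sigma> t))" using False by (simp add: ok_def)
        define \<sigma>' where "\<sigma>' = \<sigma>(t := True)"
        have poor: "S \<sigma>' t" using top[OF tSp(3)] by (simp add: \<sigma>'_def)
        \<comment> \<open>If \<open>w\<close> reached \<open>t\<close> along owned arcs,
          \<open>desc\<close> would rank \<open>t\<close> strictly below \<open>v\<close>, against
          the order of insertion. For \<open>v = t\<close> it would rank \<open>t\<close> below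
          itself.\<close>
        have same: "S \<sigma>' w = S \<sigma> w" if "v \<in> insert t T" "w \<in> shared f v" "w \<noteq> t" for v w
        proof -
          have "(w, t) \<notin> (owned f)\<^sup>*"
          proof
            assume "(w, t) \<in> (owned f)\<^sup>*"
            then have "(w, t) \<in> (owned f)\<^sup>+" using that(3) by (simp add: rtrancl_eq_or_trancl)
            then have "load f t - \<rho> t < load f v - \<rho> v"
              using desc[OF that(2)] over that(1) TSp by auto
            then show False using insert.hyps that(1) by fastforce
          qed
          then show ?thesis using upd by (simp add: \<sigma>'_def)
        qed
        have "ok \<sigma>' t"
        proof -
          \<comment> \<open>The shared neighbours of \<open>t\<close> keep their states, and none of
            them can conflict with both states of \<open>t\<close>. So the poor state gets only the
            shared edges left over by the rich one.\<close>
          have "conf \<sigma>' t \<inter> conf \<sigma> t = {}"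
          proof (rule ccontr)
            assume "conf \<sigma>' t \<inter> conf \<sigma> t \<noteq> {}"
            then obtain w where w: "w \<in> conf \<sigma>' t" "w \<in> conf \<sigma> t" by blast
            then have sh: "w \<in> shared f t" using conf_shared by blast
            then have "w \<noteq> t" using pos_arc(5)[OF f, of t w] by (auto simp: shared_def)
            then have "S \<sigma>' w = S \<sigma> w" using same[OF _ sh] by blast
            then have "cf t (S \<sigma>' t) w (S \<sigma> w)" "cf t (S \<sigma> t) w (S \<sigma> w)"
              using w by (simp_all add: conf_def)
            then have "S \<sigma>' t = S \<sigma> t" by (rule match)
            then show False using rich poor by simp
          qed
          then have "card (conf \<sigma>' t) + card (conf \<sigma> t) = card (conf \<sigma>' t \<union> conf \<sigma> t)"
            by (rule card_Un_disjoint[OF fin_conf fin_conf, symmetric])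
          also have "\<dots> \<le> card (shared f t)"
            using conf_shared by (intro card_mono[OF finite_shared[OF f]] Un_least)
          finally show ?thesis using few[OF tSp(2)] many poor by (simp add: ok_def)
        qed
        moreover have "ok \<sigma>' v" if vT: "v \<in> T" for v
        proof -
          have vSp: "v \<in> Sp" and vt: "v \<noteq> t" using TSp tT vT by auto
          then have Sv: "S \<sigma>' v = S \<sigma> v" using top by (simp add: Sp_def \<sigma>'_def)
          have "conf \<sigma>' v \<subseteq> conf \<sigma> v"
          proof
            fix w assume w: "w \<in> conf \<sigma>' v"
            then have sh: "w \<in> shared f v" using conf_shared by blast
            show "w \<in> conf \<sigma> v"
            proof (cases "w = t")
              case True
              \<comment> \<open>As a rich vertex, \<open>t\<close> was in conflict with all its
                shared neighbours, \<open>v\<close> among them. By \<open>match\<close> the poor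
                \<open>t\<close> is not in conflict with \<open>v\<close>.\<close>
              have "conf \<sigma> t = shared f t"
                using adj_special[OF vSp tSp(1)] sh True many
                by (intro card_seteq[OF finite_shared[OF f] conf_shared]) simp
              then have "v \<in> conf \<sigma> t" using shared_sym[OF f sh] True by simp
              then have "cf t (S \<sigma> t) v (S \<sigma> v)" by (simp add: conf_def)
              moreover have "cf v (S \<sigma> v) t (S \<sigma>' t)" using w True Sv by (simp add: conf_def)
              ultimately have "S \<sigma> t = S \<sigma>' t" using match[OF _ sym] by blast
              then show ?thesis using rich poor by simp
            next
              case False
              then show ?thesis using w same[OF _ sh] vT Sv by (simp add: conf_def)
            qed
          qed
          then have "card (conf \<sigma>' v) \<le> card (conf \<sigma> v)"
            by (rule card_mono[OF fin_conf])
          then show ?thesis using \<sigma>(2)[OF vT] Sv by (simp add: ok_def)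
        qed
        ultimately show ?thesis using \<sigma>(1) by (intro exI[of _ \<sigma>']) (auto simp: \<sigma>'_def)
      qed
    qed
  qed
  have "finite Sp" using finV by (simp add: Sp_def)
  from greedy[OF this] obtain \<sigma> where
    \<sigma>: "\<And>u. u \<notin> Sp \<Longrightarrow> \<not> \<sigma> u" "\<And>v. v \<in> Sp \<Longrightarrow> ok \<sigma> v" by auto
  have "ok \<sigma> v" if v: "v \<in> V" for v
  proof (cases "v \<in> Domain (owned f)")
    case True
    then obtain w where vw: "(v, w) \<in> owned f" by auto
    \<comment> \<open>This bounds the conflicts by \<open>c1 v + c2 v - j\<close>. As
      \<open>c2 v \<le> j\<close> and \<open>c1 v \<le> i \<le> j\<close>, either capacity
      suffices.\<close>
    have "d + int (card (conf \<sigma> v)) \<le> \<rho> v"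
      using card_shared_owner[OF f vw] owner[OF vw] conf_le[of \<sigma> v] by simp
    then show ?thesis using cap[OF v] d d2 ij by (simp add: ok_def \<rho>_def)
  next
    case False
    show ?thesis
    proof (cases "v \<in> Sp")
      case nSp: False
      then show ?thesis
        using False v \<sigma>(1)[OF nSp] top[OF False] conf_le[of \<sigma> v] by (auto simp: ok_def Sp_def)
    qed (use \<sigma> in blast)
  qed
  then show ?thesis unfolding ok_def conf_def by (intro exI[of _ "S \<sigma>"]) blast
qed

end

section \<open>Coloring covers\<close>

lemma card_ordered_edges:
  assumes "finite E" and "\<And>e. e \<in> E \<Longrightarrow> card e = 2"
  shows "card {(a, b). {a, b} \<in> E} = 2 * card E"
proof -
  have pair: "card {(a, b). {a, b} = e} = 2" if e: "e \<in> E" for e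
  proof -
    obtain x y where xy: "e = {x, y}" "x \<noteq> y" using assms(2)[OF e] by (auto simp: card_2_iff)
    then have "{(a, b). {a, b} = e} = {(x, y), (y, x)}" by (auto simp: doubleton_eq_iff)
    then show ?thesis using xy(2) by simp
  qed
  have "{(a, b). {a, b} \<in> E} = (\<Union>e\<in>E. {(a, b). {a, b} = e})" by auto
  also have "card \<dots> = (\<Sum>e\<in>E. card {(a, b). {a, b} = e})"
  proof (intro card_UN_disjoint ballI impI)
    fix e assume "e \<in> E"
    then show "finite {(a, b). {a, b} = e}" by (intro card_ge_0_finite) (simp add: pair)
  qed (use assms(1) in auto)
  also have "\<dots> = (\<Sum>e\<in>E. 2)" by (rule sum.cong[OF refl pair])
  finally show ?thesis by simp
qed

lemma cover_coloring_exists: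
  fixes L :: "'a \<Rightarrow> 'h set"
  assumes i: "1 \<le> i" and ij: "2 * i + 1 \<le> j" and wp: "weighted_pair i j G c"
    and pot: "\<And>S. S \<subseteq> verts G \<Longrightarrow> i - j \<le> set_potential i j G c S"
    and cov: "two_fold_cover G L H" and pr: "poor_rich G L p r"
  shows "\<exists>\<phi>. cover_coloring G c L H p r \<phi>"
proof -
  let ?V = "verts G"
  define A where "A = {(a, b). {a, b} \<in> edges G}"
  have sg: "simple_graph G" and cap: "\<And>v. v \<in> ?V \<Longrightarrow> fst (c v) \<le> i \<and> snd (c v) \<le> j"
    using wp by (auto simp: weighted_pair_def mem_Times_iff)
  have fV: "finite ?V" and eV: "\<And>e. e \<in> edges G \<Longrightarrow> e \<subseteq> ?V" "\<And>e. e \<in> edges G \<Longrightarrow> card e = 2"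
    using sg by (auto simp: simple_graph_def)
  have fE: "finite (edges G)" using fV eV(1) by (meson Pow_iff finite_Pow_iff finite_subset subsetI)
  interpret split_graph ?V A "i + 1"
  proof
    show "irrefl A" using eV(2) by (force simp: irrefl_def A_def)
  qed (use fV eV i in \<open>auto simp: A_def sym_def insert_commute\<close>)
  \<comment> \<open>\<open>A\<close> counts each edge twice, hence the doubled form of the potential
    bound.\<close>
  have B: "(i + 1) * int (card (A \<inter> S \<times> S))
      \<le> 2 * ((j - i) + (\<Sum>v\<in>S. i - j + 1 + fst (c v) + snd (c v)))" if S: "S \<subseteq> ?V" for S
  proof -
    have "A \<inter> S \<times> S = {(a, b). {a, b} \<in> edges (induced G S)}"
      by (auto simp: A_def induced_def)
    also have "card \<dots> = 2 * card (edges (induced G S))"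
      using fE eV(2) by (intro card_ordered_edges) (auto simp: induced_def)
    finally show ?thesis using pot[OF S] by (simp add: set_potential_def vertex_potential_def)
  qed
  define st where "st u b = (if b then p u else r u)" for u b
  have Lpr: "L u = {p u, r u}" and ne: "p u \<noteq> r u" if "u \<in> ?V" for u
  proof -
    show Lu: "L u = {p u, r u}" using pr that by (auto simp: poor_rich_def)
    have "card (L u) = 2" using cov that by (auto simp: two_fold_cover_def)
    then show "p u \<noteq> r u" using Lu by auto
  qed
  have stL: "st u b \<in> L u" if "u \<in> ?V" for u b using Lpr[OF that] by (simp add: st_def)
  have st_eq: "u = w \<and> a = b" if "st u a = st w b" "u \<in> ?V" "w \<in> ?V" for u a w b
  proof -
    have "L u \<inter> L w \<noteq> {}" using stL that by (metis disjoint_iff)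
    then have "u = w"
      using cov that(2,3) unfolding two_fold_cover_def disjoint_family_on_def by blast
    then show ?thesis using that(1) ne[OF that(2)] by (auto simp: st_def split: if_splits)
  qed
  \<comment> \<open>The edge inside \<open>L u\<close> is excluded, since a map selects only one end
    of it.\<close>
  define cf where "cf u a w b \<longleftrightarrow> u \<in> ?V \<and> w \<in> ?V \<and> u \<noteq> w \<and> {st u a, st w b} \<in> edges H" for u a w b
  have betw: "{st u a, st w b} \<in> edges_between H (L u) (L w)" if "cf u a w b" for u a w b
    using that stL by (auto simp: cf_def edges_between_def)
  have adj: "{u, w} \<in> edges G" if "cf u a w b" for u a w b
    using cov betw[OF that] that unfolding two_fold_cover_def cf_def by blast
  \<comment> \<open>Two edges of the cover with the common end \<open>st w b\<close> belong to one
    matching, so they coincide.\<close>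
  have match: "a = a'" if cf: "cf u a w b" "cf u a' w b" for u a a' w b
  proof -
    have V: "u \<in> ?V" "w \<in> ?V" "u \<noteq> w" using cf by (auto simp: cf_def)
    have "disjoint (edges_between H (L u) (L w))"
      using cov adj[OF cf(1)] V unfolding two_fold_cover_def by blast
    then have "{st u a, st w b} = {st u a', st w b}"
      using betw[OF cf(1)] betw[OF cf(2)] by (auto dest: disjointD)
    then have "st u a = st u a'" by (auto simp: doubleton_eq_iff)
    then show ?thesis using st_eq V by blast
  qed
  have sym: "cf w b u a" if "cf u a w b" for u a w b
    using that by (auto simp: cf_def insert_commute)
  have adjA: "(u, w) \<in> A" if "cf u a w b" for u a w b
    using adj[OF that] by (simp add: A_def)
  have "\<exists>s. \<forall>v\<in>?V. int (card {w. cf v (s v) w (s w)}) \<le> (if s v then fst (c v) else snd (c v))"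
    by (rule defective_states[OF refl ij cap B, where cf = cf])
      (assumption | erule sym | erule (1) match | erule adjA)+
  then obtain s where s: "\<And>v. v \<in> ?V \<Longrightarrow>
      int (card {w. cf v (s v) w (s w)}) \<le> (if s v then fst (c v) else snd (c v))"
    by auto
  define \<phi> where "\<phi> u = st u (s u)" for u
  have deg: "degree (induced H (\<phi> ` ?V)) (\<phi> u) \<le> card {w. cf u (s u) w (s w)}" if u: "u \<in> ?V" for u
  proof -
    let ?W = "{w. cf u (s u) w (s w)}"
    have finW: "finite ?W" by (rule finite_subset[OF _ fV]) (auto simp: cf_def)
    have "{e \<in> edges (induced H (\<phi> ` ?V)). \<phi> u \<in> e} \<subseteq> (\<lambda>w. {\<phi> u, \<phi> w}) ` ?W"
    proof
      fix e assume "e \<in> {e \<in> edges (induced H (\<phi> ` ?V)). \<phi> u \<in> e}"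
      then have e: "e \<in> edges H" "e \<subseteq> \<phi> ` ?V" "\<phi> u \<in> e" by (auto simp: induced_def)
      have "card e = 2" using cov e(1) by (auto simp: two_fold_cover_def simple_graph_def)
      then obtain y where y: "e = {\<phi> u, y}" "y \<noteq> \<phi> u"
        using e(3) by (auto simp: card_2_iff)
      then obtain w where "w \<in> ?V" "y = \<phi> w" using e(2) by auto
      then show "e \<in> (\<lambda>w. {\<phi> u, \<phi> w}) ` ?W"
        using y e(1) u by (auto simp: cf_def \<phi>_def)
    qed
    then show ?thesis
      unfolding degree_def using finW by (meson card_image_le card_mono finite_imageI le_trans)
  qed
  have "cover_coloring G c L H p r \<phi>"
    unfolding cover_coloring_def
  proof (intro conjI ballI impI)
    show "cover_map G L \<phi>" using stL by (simp add: cover_map_def \<phi>_def)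
  next
    fix u assume u: "u \<in> ?V" and "\<phi> u = p u"
    then have "s u" using ne[OF u] by (auto simp: \<phi>_def st_def split: if_splits)
    then show "int (degree (induced H (\<phi> ` ?V)) (\<phi> u)) \<le> fst (c u)" using deg[OF u] s[OF u] by simp
  next
    fix u assume u: "u \<in> ?V" and "\<phi> u = r u"
    then have "\<not> s u" using ne[OF u] by (auto simp: \<phi>_def st_def split: if_splits)
    then show "int (degree (induced H (\<phi> ` ?V)) (\<phi> u)) \<le> snd (c u)" using deg[OF u] s[OF u] by simp
  qed
  then show ?thesis by blast
qed

theorem theorem3p5:
  fixes i j :: int and G :: "'a ugraph" and c :: "'a capacity"
  assumes "i \<ge> 3" and "j \<ge> 2 * i + 1"
    and "weighted_pair i j G c"
    and "critical G c"
  shows "potential i j G c \<le> i - j - 1"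
proof (rule ccontr)
  assume "\<not> ?thesis"
  moreover have "finite (verts G)" using assms(3) by (simp add: weighted_pair_def simple_graph_def)
  ultimately have "i - j \<le> set_potential i j G c S" if "S \<subseteq> verts G" for S
    using that Min_le[of "set_potential i j G c ` Pow (verts G)" "set_potential i j G c S"]
    unfolding potential_def by fastforce
  then have "colorable G c"
    unfolding colorable_def using cover_coloring_exists[OF _ assms(2,3)] assms(1) by fastforce
  then show False using assms(4) by (simp add: critical_def)
qed

end
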